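(* Let $n\ge 3$ be an integer. The minimum number of edges in a graph $G$ of order $n$ that satisfies $d_G(x) + d_G(y) \geq n+1$ for all pairs of vertices $x \neq y$ with $xy \notin E(G)$ is given by the following tight lower bound (where $k$ is a positive integer): $$|E(G)| \geq \begin{cases} 4k^2 - k & \text{if } n =4k-1,\\ 4k^2 + k + 1 & \text{if } n = 4k,\\ 4k^2 + 3k + 1 & \text{if } n = 4k+1,\\ 4k^2 + 5k + 2 & \text{if } n = 4k+2.\end{cases}$$ That is, every such graph satisfies this inequality, and for every $n \geq 3$ some such graph attains equality. In other words, the minimum of $|E(G)|$ is $\frac{n^2}{4} + \frac{n}{4} + c$, where $c=0$ if $n \equiv 3 \pmod 4$, $c=\frac{1}{2}$ if $n\equiv 1,2 \pmod 4$, and $c=1$ if $n \equiv 0 \pmod 4$.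
   Context: Graphs are finite and simple; $d_G(x)$ denotes the degree of the vertex $x$ in $G$. *)

theory Defs
  imports Complex_Main
begin

text \<open>A finite simple graph is given by its vertex set \<open>V\<close> and its set \<open>E\<close> of edges, each edge
  being a two-element subset of \<open>V\<close>; so \<open>card V\<close> is the order and \<open>card E\<close> the number of edges.\<close>

definition simple_graph :: "'a set \<Rightarrow> 'a set set \<Rightarrow> bool" where
  "simple_graph V E \<longleftrightarrow> finite V \<and> E \<subseteq> {e. e \<subseteq> V \<and> card e = 2}"

definition vdegree :: "'a set set \<Rightarrow> 'a \<Rightarrow> nat" where
  "vdegree E x = card {e \<in> E. x \<in> e}"

definition degree_sum_graph :: "nat \<Rightarrow> 'a set \<Rightarrow> 'a set set \<Rightarrow> bool" where
  "degree_sum_graph n V E \<longleftrightarrow>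
     simple_graph V E \<and> card V = n \<and>
     (\<forall>x\<in>V. \<forall>y\<in>V. x \<noteq> y \<and> {x, y} \<notin> E \<longrightarrow> vdegree E x + vdegree E y \<ge> n + 1)"

text \<open>Every finite graph is isomorphic to one whose vertices are natural numbers, so it suffices to
  range over these. The set of values is never empty, since it contains the size of the complete
  graph of order \<open>n\<close>; hence \<open>LEAST\<close> is a genuine minimum.\<close>

definition min_size :: "nat \<Rightarrow> nat" where
  "min_size n = (LEAST m. \<exists>(V :: nat set) E. degree_sum_graph n V E \<and> card E = m)"

end

theory Submission
  imports Defs
begin

text \<open>
  Lower bound. Let \<open>v\<close> have minimum degree \<open>d\<close>. If \<open>2 * d > n\<close>, the handshake lemma and the
  parity of \<open>n\<close> suffice. If \<open>2 * d \<le> n\<close>, then each of the \<open>n - 1 - d\<close> vertices that are not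
  adjacent to \<open>v\<close> has degree at least \<open>n + 1 - d\<close>, and the \<open>d + 1\<close> remaining ones have degree at
  least \<open>d\<close>, so the degrees sum to at least \<open>d * (d + 1) + (n - 1 - d) * (n + 1 - d)\<close>. This
  would be slightly too small, but equality is far from possible: if the neighbours of \<open>v\<close> all had
  degree about \<open>d\<close>, they would form a clique with almost no edges leaving it, whereas every
  non-neighbour of \<open>v\<close> has too large a degree to do without such edges. Lemma
  \<open>neighbour_degree_sum\<close> turns this into a gain of 2, and the divisibility of an integer by 4
  closes the remaining gap (\<open>size_lower_bound\<close>).

  Sharpness. Extremal graphs of order \<open>n + 4\<close> arise from those of order \<open>n\<close> by adding four
  vertices \<open>a, b, c, d\<close> that span all edges but \<open>{c, d}\<close>, where \<open>a, b\<close> are joined to a part \<open>X\<close> of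
  the old vertices and \<open>c, d\<close> to the complementary part \<open>Y\<close>. All old degrees then grow by 2,
  which is just what the condition for \<open>n + 4\<close> demands, and the \<open>2 * n + 5\<close> new edges are exactly
  the growth of the bound. The degrees of the new vertices suffice if \<open>Y\<close> has \<open>n div 2 + 1\<close>
  elements and if, for even \<open>n\<close>, every vertex of degree \<open>n / 2\<close> lies in \<open>X\<close>. This invariant
  (\<open>sharp_graph\<close>) passes to \<open>n + 4\<close> with \<open>c, d\<close> added to \<open>Y\<close>, and the orders 3 to 6 start the
  induction.
\<close>

section \<open>Degrees and neighbourhoods\<close>

definition nbrs :: "'a set set \<Rightarrow> 'a \<Rightarrow> 'a set" where
  "nbrs E x = {y. {x, y} \<in> E}"

lemma nbrs_sym: "y \<in> nbrs E x \<longleftrightarrow> x \<in> nbrs E y"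
  by (simp add: nbrs_def insert_commute)

lemma nbrs_subset:
  assumes "simple_graph V E"
  shows "nbrs E x \<subseteq> V - {x}"
  using assms by (auto simp: simple_graph_def nbrs_def)

lemma simple_graph_finite_edges:
  assumes "simple_graph V E"
  shows "finite E"
proof -
  have "E \<subseteq> Pow V" "finite V" using assms by (auto simp: simple_graph_def)
  then show ?thesis by (meson finite_Pow_iff finite_subset)
qed

lemma card_nbrs:
  assumes "simple_graph V E"
  shows "card (nbrs E x) = vdegree E x"
proof -
  have "{e \<in> E. x \<in> e} = (\<lambda>y. {x, y}) ` nbrs E x"
  proof
    show "{e \<in> E. x \<in> e} \<subseteq> (\<lambda>y. {x, y}) ` nbrs E x"
    proof
      fix e assume e: "e \<in> {e \<in> E. x \<in> e}"
      then have "card e = 2" using assms by (auto simp: simple_graph_def)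
      then obtain y z where "e = {y, z}" by (auto simp: card_2_iff)
      then show "e \<in> (\<lambda>y. {x, y}) ` nbrs E x"
        using e by (auto simp: nbrs_def insert_commute)
    qed
  qed (auto simp: nbrs_def)
  moreover have "inj_on (\<lambda>y. {x, y}) (nbrs E x)"
    by (auto simp: inj_on_def doubleton_eq_iff)
  ultimately show ?thesis by (simp add: vdegree_def card_image)
qed

lemma handshake:
  assumes "simple_graph V E"
  shows "(\<Sum>x\<in>V. vdegree E x) = 2 * card E"
proof -
  have fin: "finite V" "finite E"
    using assms simple_graph_finite_edges by (auto simp: simple_graph_def)
  have "card {x \<in> V. x \<in> e} = 2" if "e \<in> E" for e
  proof -
    have "{x \<in> V. x \<in> e} = e" "card e = 2" using assms that by (auto simp: simple_graph_def)
    then show ?thesis by simp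
  qed
  then have "(\<Sum>x\<in>V. card {e \<in> E. x \<in> e}) = 2 * card E"
    using sum_multicount[OF fin] by auto
  then show ?thesis by (simp add: vdegree_def)
qed

section \<open>The lower bound\<close>

text \<open>Otherwise all neighbours of \<open>v\<close> but one, \<open>w\<close>, have degree exactly \<open>d\<close>. As \<open>2 * d < n + 1\<close>,
  these form together with \<open>v\<close> a clique of \<open>d\<close> vertices, each having at most one neighbour outside.
  But each of the \<open>n - 1 - d\<close> vertices not adjacent to \<open>v\<close> has, by its degree, at least two
  neighbours in the clique, and counting these edges from both sides is contradictory.\<close>

lemma neighbour_degree_sum:
  assumes G: "degree_sum_graph n V E" and n: "n \<ge> 3"
    and v: "v \<in> V" and min: "\<And>x. x \<in> V \<Longrightarrow> d \<le> vdegree E x"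
    and d: "vdegree E v = d" and small: "2 * d \<le> n"
  shows "(\<Sum>x\<in>nbrs E v. vdegree E x) \<ge> d * d + 2"
proof (rule ccontr)
  assume less: "\<not> ?thesis"
  have S: "simple_graph V E" and cV: "card V = n" and fV: "finite V"
    using G by (auto simp: degree_sum_graph_def simple_graph_def)
  define N where "N = nbrs E v"
  define B where "B = V - insert v N"
  have NV: "N \<subseteq> V - {v}" using nbrs_subset[OF S] by (simp add: N_def)
  have fN: "finite N" using NV fV finite_subset by fast
  have fB: "finite B" using fV by (simp add: B_def)
  have cN: "card N = d" using card_nbrs[OF S] d by (simp add: N_def)
  have "card (insert v N) = d + 1" using NV fN cN by (subst card_insert_disjoint) auto
  then have cB: "card B = n - 1 - d"
    unfolding B_def using NV v fN cV by (subst card_Diff_subset) auto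
  have fin_nbrs: "finite (nbrs E x)" for x
    using nbrs_subset[OF S] fV by (meson finite_Diff finite_subset)
  have degB: "vdegree E b \<ge> n + 1 - d" if "b \<in> B" for b
  proof -
    have "b \<in> V" "v \<noteq> b" "{v, b} \<notin> E" using that by (auto simp: B_def N_def nbrs_def)
    then have "vdegree E v + vdegree E b \<ge> n + 1"
      using G v unfolding degree_sum_graph_def by blast
    then show ?thesis using d by simp
  qed
  have "card B > 0" using cB small n by simp
  then obtain b where "b \<in> B" by fastforce
  have "d > 0"
  proof (rule ccontr)
    assume "\<not> d > 0"
    then have "vdegree E b \<ge> n + 1" using degB[OF \<open>b \<in> B\<close>] by simp
    moreover have "vdegree E b \<le> n"
      using card_mono[of V "nbrs E b"] nbrs_subset[OF S, of b] fV cV card_nbrs[OF S, of b] by auto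
    ultimately show False by simp
  qed
  \<comment> \<open>the only neighbour of \<open>v\<close> whose degree may exceed \<open>d\<close>, if there is one\<close>
  obtain w where w: "w \<in> N" and wmax: "\<And>x. x \<in> N \<Longrightarrow> vdegree E x > d \<Longrightarrow> vdegree E w > d"
  proof (cases "\<exists>x\<in>N. vdegree E x > d")
    case False
    moreover obtain w where "w \<in> N" using \<open>d > 0\<close> cN by fastforce
    ultimately show ?thesis using that by blast
  qed (use that in blast)
  define M where "M = N - {w}"
  have fM: "finite M" using fN by (simp add: M_def)
  have cM: "card M = d - 1" using w cN fN by (simp add: M_def)
  have degM: "vdegree E x = d" if x: "x \<in> M" for x
  proof (rule ccontr)
    assume neq: "vdegree E x \<noteq> d"
    have xN: "x \<in> N" "x \<noteq> w" using x by (auto simp: M_def)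
    have "x \<in> V" using xN NV by blast
    then have gx: "vdegree E x > d" using min[OF \<open>x \<in> V\<close>] neq by linarith
    have "card (M - {x}) = d - 2" using cM x fM by simp
    moreover have "(\<Sum>y\<in>M - {x}. vdegree E y) \<ge> card (M - {x}) * d"
      using sum_bounded_below[of "M - {x}" d "vdegree E"] min NV M_def by auto
    moreover have "(\<Sum>y\<in>N. vdegree E y) = vdegree E w + (\<Sum>y\<in>M. vdegree E y)"
      using sum.remove[OF fN w] by (simp add: M_def)
    moreover have "(\<Sum>y\<in>M. vdegree E y) = vdegree E x + (\<Sum>y\<in>M - {x}. vdegree E y)"
      using sum.remove[OF fM x] .
    moreover have "vdegree E w > d" using wmax xN gx by blast
    moreover have "d \<ge> 2"
      using card_mono[OF fN, of "{x, w}"] xN w cN by auto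
    moreover have "(d - 2) * d + 2 * d = d * d"
      using \<open>d \<ge> 2\<close> by (metis add_mult_distrib le_add_diff_inverse2)
    ultimately have "(\<Sum>y\<in>N. vdegree E y) \<ge> d * d + 2" using gx by simp
    then show False using less by (simp add: N_def)
  qed
  have clique: "y \<in> nbrs E x" if "x \<in> M" "y \<in> M" "x \<noteq> y" for x y
  proof (rule ccontr)
    assume "y \<notin> nbrs E x"
    moreover have "x \<in> V" "y \<in> V" using that NV by (auto simp: M_def)
    ultimately have "vdegree E x + vdegree E y \<ge> n + 1"
      using G that by (auto simp: degree_sum_graph_def nbrs_def)
    then show False using degM that small by simp
  qed
  have few: "card {b \<in> B. b \<in> nbrs E x} \<le> 1" if x: "x \<in> M" for x
  proof -
    let ?I = "insert v (M - {x})" and ?O = "{b \<in> B. b \<in> nbrs E x}"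
    have "v \<in> nbrs E x" using x by (simp add: M_def N_def nbrs_sym)
    then have "?I \<union> ?O \<subseteq> nbrs E x" using clique x by auto
    then have "card (?I \<union> ?O) \<le> d"
      using card_mono[OF fin_nbrs] card_nbrs[OF S, of x] degM[OF x] by metis
    moreover have "card (?I \<union> ?O) = card ?I + card ?O"
      using fM fB by (intro card_Un_disjoint) (auto simp: B_def M_def)
    moreover have "card ?I = Suc (card (M - {x}))"
      using NV fM by (intro card_insert_disjoint) (auto simp: M_def)
    moreover have "card M > 0" using x fM card_gt_0_iff by blast
    ultimately show ?thesis using x fM cM by simp
  qed
  have many: "card {x \<in> M. b \<in> nbrs E x} \<ge> 2" if b: "b \<in> B" for b
  proof -
    let ?I = "insert w (B - {b})" and ?O = "{x \<in> M. b \<in> nbrs E x}"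
    have "v \<notin> nbrs E b" using b by (auto simp: B_def N_def nbrs_sym)
    then have "nbrs E b \<subseteq> ?I \<union> ?O"
      using nbrs_subset[OF S, of b] by (auto simp: B_def M_def N_def nbrs_sym)
    then have "vdegree E b \<le> card (?I \<union> ?O)"
      unfolding card_nbrs[OF S, symmetric] using fB fM by (intro card_mono) auto
    also have "\<dots> \<le> card ?I + card ?O" by (rule card_Un_le)
    also have "card ?I \<le> Suc (card (B - {b}))" by (rule card_insert_le_m1) auto
    finally show ?thesis using degB[OF b] cB b fB small n by simp
  qed
  have "2 * card B \<le> (\<Sum>b\<in>B. card {x \<in> M. b \<in> nbrs E x})"
    using sum_bounded_below[of B 2 "\<lambda>b. card {x \<in> M. b \<in> nbrs E x}"] many by auto
  also have "\<dots> = (\<Sum>x\<in>M. card {b \<in> B. b \<in> nbrs E x})"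
    using sum_multicount_gen[OF fB fM, of "\<lambda>b x. b \<in> nbrs E x" "\<lambda>x. card {b \<in> B. b \<in> nbrs E x}"]
    by simp
  also have "\<dots> \<le> card M"
    using sum_bounded_above[of M "\<lambda>x. card {b \<in> B. b \<in> nbrs E x}" 1] few by auto
  finally show False using cB cM small n by simp
qed

text \<open>Four times the value at \<open>n\<close> of the constant \<open>c\<close> in \<open>n\<^sup>2 / 4 + n / 4 + c\<close>.\<close>

definition excess :: "nat \<Rightarrow> nat" where
  "excess n = (if n mod 4 = 3 then 0 else if n mod 4 = 0 then 4 else 2)"

text \<open>With \<open>n = 2 * d + t\<close> and minimum degree \<open>d\<close>, twice the degree sum is, for \<open>t \<ge> 0\<close>, at least
  \<open>n\<^sup>2 + n + 2 + t * (t - 1)\<close>, so the worst cases are \<open>t = 0\<close> and \<open>t = 1\<close>. For \<open>t < 0\<close> the product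
  \<open>n * d\<close> already bounds the degree sum; this is where odd orders can do with less, since
  \<open>2 * d = n + 1\<close> is possible for them, whereas an even \<open>n\<close> forces \<open>2 * d \<ge> n + 2\<close>.\<close>

lemma size_lower_bound:
  assumes G: "degree_sum_graph n V E" and n: "n \<ge> 3"
  shows "4 * card E \<ge> n\<^sup>2 + n + excess n"
proof -
  have S: "simple_graph V E" and cV: "card V = n" and fV: "finite V"
    using G by (auto simp: degree_sum_graph_def simple_graph_def)
  have "V \<noteq> {}" using cV n by auto
  define d where "d = Min (vdegree E ` V)"
  have min: "d \<le> vdegree E x" if "x \<in> V" for x using that fV by (simp add: d_def)
  have "d \<in> vdegree E ` V" unfolding d_def using fV \<open>V \<noteq> {}\<close> by (intro Min_in) auto
  then obtain v where v: "v \<in> V" and dv: "vdegree E v = d" by auto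
  have weak: "4 * card E \<ge> n\<^sup>2 + n + (if n mod 4 = 3 \<or> n mod 4 = 1 then 0 else 2)"
  proof (cases "2 * d \<le> n")
    case True
    define N where "N = nbrs E v"
    define B where "B = V - insert v N"
    have NV: "N \<subseteq> V - {v}" using nbrs_subset[OF S] by (simp add: N_def)
    have fN: "finite N" using NV fV finite_subset by fast
    have "card (insert v N) = d + 1" 
      using NV fN card_nbrs[OF S, of v] dv by (subst card_insert_disjoint) (auto simp: N_def)
    then have cB: "card B = n - 1 - d"
      unfolding B_def using NV v fN cV by (subst card_Diff_subset) auto
    have "n + 1 - d \<le> vdegree E b" if "b \<in> B" for b
    proof -
      have "b \<in> V" "v \<noteq> b" "{v, b} \<notin> E" using that by (auto simp: B_def N_def nbrs_def)
      then have "vdegree E v + vdegree E b \<ge> n + 1"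
        using G v unfolding degree_sum_graph_def by blast
      then show ?thesis using dv by simp
    qed
    then have sumB: "(\<Sum>x\<in>B. vdegree E x) \<ge> (n - 1 - d) * (n + 1 - d)"
      using sum_bounded_below[of B "n + 1 - d" "vdegree E"] cB by auto
    have sumN: "(\<Sum>x\<in>N. vdegree E x) \<ge> d * d + 2"
      unfolding N_def using neighbour_degree_sum[OF G n v min dv True] by blast
    have V: "V = insert v N \<union> B" using NV v by (auto simp: B_def)
    have "(\<Sum>x\<in>V. vdegree E x) = (\<Sum>x\<in>insert v N. vdegree E x) + (\<Sum>x\<in>B. vdegree E x)"
      by (subst V, rule sum.union_disjoint) (use fN fV in \<open>auto simp: B_def\<close>)
    also have "(\<Sum>x\<in>insert v N. vdegree E x) = d + (\<Sum>x\<in>N. vdegree E x)"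
      using NV fN dv by (subst sum.insert) auto
    finally have "2 * card E \<ge> d + (d * d + 2) + (n - 1 - d) * (n + 1 - d)"
      using handshake[OF S] sumB sumN by simp
    moreover obtain t where t: "n = 2 * d + t" using True by (metis le_Suc_ex)
    ultimately have le: "2 * card E \<ge> d + d * d + 2 + (d + t - 1) * (d + t + 1)" by simp
    have "d + t \<ge> 1" using t n by simp
    then have "(d + t - 1) * (d + t + 1) + 1 = (d + t) * (d + t)"
      by (cases "d + t") auto
    then have "2 * card E \<ge> d + d * d + 1 + (d + t) * (d + t)" using le by simp
    then have "4 * card E \<ge> 2 * (d + d * d + 1 + (d + t) * (d + t))" by simp
    moreover have "2 * (d + d * d + 1 + (d + t) * (d + t)) + t = n\<^sup>2 + n + 2 + t * t"
      by (simp add: t power2_eq_square algebra_simps)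
    ultimately have "4 * card E \<ge> n\<^sup>2 + n + 2" using le_square[of t] by linarith
    then show ?thesis by simp
  next
    case False
    have "n * d \<le> 2 * card E"
      using sum_bounded_below[of V d "vdegree E"] min cV handshake[OF S] by auto
    then have nd: "n * (2 * d) \<le> 4 * card E" by (simp add: mult.commute)
    show ?thesis
    proof (cases "even n")
      case True
      then have "n + 2 \<le> 2 * d" using False by presburger
      then have "n * (n + 2) \<le> 4 * card E" using nd mult_le_mono2 order_trans by blast
      then show ?thesis using n by (simp add: power2_eq_square)
    next
      case odd: False
      have "n + 1 \<le> 2 * d" using False by simp
      then have "n * (n + 1) \<le> 4 * card E" using nd mult_le_mono2 order_trans by blast
      moreover have "n mod 4 = 3 \<or> n mod 4 = 1" using odd by presburger
      ultimately show ?thesis by (simp add: power2_eq_square)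
    qed
  qed
  \<comment> \<open>\<open>4 * card E\<close> is a multiple of 4, so the weak bound may be rounded up to one\<close>
  obtain q where q: "n = 4 * q + n mod 4" by (metis mult_div_mod_eq)
  consider "n mod 4 = 0" | "n mod 4 = 1" | "n mod 4 = 2" | "n mod 4 = 3" by linarith
  then show ?thesis
  proof cases
    case 1
    then have eq: "n\<^sup>2 + n = 4 * (4 * q * q + q)"
      using q by (simp add: power2_eq_square algebra_simps)
    then have "4 * (4 * q * q + q) + 2 \<le> 4 * card E" using weak 1 by simp
    then have "4 * (4 * q * q + q) + 4 \<le> 4 * card E" by presburger
    then show ?thesis using eq 1 by (simp add: excess_def)
  next
    case 2
    then have eq: "n\<^sup>2 + n = 4 * (4 * q * q + 3 * q) + 2"
      using q by (simp add: power2_eq_square algebra_simps)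
    then have "4 * (4 * q * q + 3 * q) + 2 \<le> 4 * card E" using weak 2 by simp
    then have "4 * (4 * q * q + 3 * q) + 4 \<le> 4 * card E" by presburger
    then show ?thesis using eq 2 by (simp add: excess_def)
  qed (use weak in \<open>auto simp: excess_def\<close>)
qed

section \<open>Attaching a vertex\<close>

definition attach :: "'a \<Rightarrow> 'a set \<Rightarrow> 'a set set \<Rightarrow> 'a set set" where
  "attach v S E = E \<union> (\<lambda>s. {v, s}) ` S"

context
  fixes V S :: "'a set" and E :: "'a set set" and v :: 'a
  assumes graph: "simple_graph V E" and fresh: "v \<notin> V" and sub: "S \<subseteq> V"
begin

lemma simple_graph_attach: "simple_graph (insert v V) (attach v S E)"
  using graph fresh sub by (auto simp: simple_graph_def attach_def card_insert_if)

lemma card_attach: "card (attach v S E) = card E + card S"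
proof -
  have "finite S" using graph sub by (auto simp: simple_graph_def intro: finite_subset)
  moreover have "E \<inter> (\<lambda>s. {v, s}) ` S = {}" using graph fresh by (auto simp: simple_graph_def)
  moreover have "inj_on (\<lambda>s. {v, s}) S" by (auto simp: inj_on_def doubleton_eq_iff)
  ultimately show ?thesis
    using simple_graph_finite_edges[OF graph]
    by (simp add: attach_def card_Un_disjoint card_image)
qed

lemma nbrs_attach:
  "nbrs (attach v S E) x = (if x = v then S else nbrs E x \<union> (if x \<in> S then {v} else {}))"
  using graph fresh sub
  by (auto simp: nbrs_def attach_def doubleton_eq_iff simple_graph_def)

lemma vdegree_attach:
  "vdegree (attach v S E) x =
    (if x = v then card S else vdegree E x + (if x \<in> S then 1 else 0))"
proof -
  have "finite (nbrs E x)" "v \<notin> nbrs E x"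
    using nbrs_subset[OF graph, of x] graph fresh
    by (auto simp: simple_graph_def intro: finite_subset)
  then show ?thesis
    by (auto simp: card_nbrs[OF simple_graph_attach, symmetric] card_nbrs[OF graph, symmetric]
        nbrs_attach)
qed

end

section \<open>Extremal graphs\<close>

text \<open>The set \<open>Y\<close> records what the induction needs beyond the degree-sum condition: a bit more
  than half of the vertices, of degree more than \<open>n / 2\<close>. For odd \<open>n\<close> the two degree bounds agree,
  and \<open>Y\<close> is just any set of the right size.\<close>

definition sharp_graph :: "nat \<Rightarrow> nat set \<Rightarrow> nat set set \<Rightarrow> bool" where
  "sharp_graph n Y E \<longleftrightarrow>
     degree_sum_graph n {..<n} E \<and> 4 * card E = n\<^sup>2 + n + excess n \<and>
     Y \<subseteq> {..<n} \<and> card Y = n div 2 + 1 \<and>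
     (\<forall>x<n. vdegree E x \<ge> (n + 1) div 2) \<and> (\<forall>y\<in>Y. vdegree E y \<ge> n div 2 + 1)"

lemma degree_sum_graph_iff_nbrs:
  "degree_sum_graph n V E \<longleftrightarrow>
     simple_graph V E \<and> card V = n \<and>
     (\<forall>x\<in>V. \<forall>y\<in>V. x \<noteq> y \<and> y \<notin> nbrs E x \<longrightarrow> vdegree E x + vdegree E y \<ge> n + 1)"
  by (simp add: degree_sum_graph_def nbrs_def)

text \<open>The new vertices \<open>n\<close> and \<open>n + 1\<close> are joined to \<open>X\<close>, the other two to \<open>Y\<close>. As \<open>X\<close> is smaller
  than \<open>Y\<close>, the missing edge among the new vertices has to be the one between the last two.
  A new vertex is then adjacent to all old vertices that might have too small a degree
  to miss it.\<close>

lemma sharp_graph_step: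
  assumes "sharp_graph n Y E"
  shows "\<exists>Y' E'. sharp_graph (n + 4) Y' E'"
proof -
  have G: "degree_sum_graph n {..<n} E" and e: "4 * card E = n\<^sup>2 + n + excess n"
    and Y: "Y \<subseteq> {..<n}" and cY: "card Y = n div 2 + 1"
    and deg: "\<And>x. x < n \<Longrightarrow> vdegree E x \<ge> (n + 1) div 2"
    and degY: "\<And>y. y \<in> Y \<Longrightarrow> vdegree E y \<ge> n div 2 + 1"
    using assms by (auto simp: sharp_graph_def)
  have S0: "simple_graph {..<n} E" using G by (simp add: degree_sum_graph_def)
  define X where "X = {..<n} - Y"
  have fin: "finite Y" "finite X" using Y by (auto simp: X_def intro: finite_subset)
  have lt: "\<And>y. y \<in> Y \<Longrightarrow> y < n" "\<And>x. x \<in> X \<Longrightarrow> x < n" using Y by (auto simp: X_def)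
  have cX: "card X + card Y = n"
    using card_Diff_subset[OF fin(1) Y] card_mono[OF _ Y] by (simp add: X_def)
  define E1 where "E1 = attach n X E"
  define E2 where "E2 = attach (Suc n) (insert n X) E1"
  define E3 where "E3 = attach (Suc (Suc n)) (insert n (insert (Suc n) Y)) E2"
  define E4 where "E4 = attach (Suc (Suc (Suc n))) (insert n (insert (Suc n) Y)) E3"
  have a1: "n \<notin> {..<n}" "X \<subseteq> {..<n}" by (auto simp: X_def)
  have S1: "simple_graph {..<Suc n} E1"
    using simple_graph_attach[OF S0 a1] by (simp add: E1_def lessThan_Suc)
  have a2: "Suc n \<notin> {..<Suc n}" "insert n X \<subseteq> {..<Suc n}" by (auto simp: X_def)
  have S2: "simple_graph {..<Suc (Suc n)} E2"
    using simple_graph_attach[OF S1 a2] by (simp add: E2_def lessThan_Suc)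
  have a3: "Suc (Suc n) \<notin> {..<Suc (Suc n)}" "insert n (insert (Suc n) Y) \<subseteq> {..<Suc (Suc n)}"
    using lt by fastforce+
  have S3: "simple_graph {..<Suc (Suc (Suc n))} E3"
    using simple_graph_attach[OF S2 a3] by (simp add: E3_def lessThan_Suc)
  have a4: "Suc (Suc (Suc n)) \<notin> {..<Suc (Suc (Suc n))}"
    "insert n (insert (Suc n) Y) \<subseteq> {..<Suc (Suc (Suc n))}"
    using lt by fastforce+
  have S4: "simple_graph {..<n + 4} E4"
    using simple_graph_attach[OF S3 a4] by (simp add: E4_def lessThan_Suc numeral_eq_Suc)
  have new: "n \<notin> X" "n \<notin> Y" "Suc n \<notin> X" "Suc n \<notin> Y" using lt by fastforce+
  have card4: "card E4 = card E + 2 * n + 5"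
    unfolding E4_def E3_def E2_def E1_def
    unfolding card_attach[OF S3[unfolded E3_def E2_def E1_def] a4]
      card_attach[OF S2[unfolded E2_def E1_def] a3] card_attach[OF S1[unfolded E1_def] a2]
      card_attach[OF S0 a1]
    using fin new cX by simp
  note vd = vdegree_attach[OF S3 a4, folded E4_def] vdegree_attach[OF S2 a3, folded E3_def]
    vdegree_attach[OF S1 a2, folded E2_def] vdegree_attach[OF S0 a1, folded E1_def]
  note nb = nbrs_attach[OF S3 a4, folded E4_def] nbrs_attach[OF S2 a3, folded E3_def]
    nbrs_attach[OF S1 a2, folded E2_def] nbrs_attach[OF S0 a1, folded E1_def]
  let ?a = n and ?b = "Suc n" and ?c = "Suc (Suc n)" and ?d = "Suc (Suc (Suc n))"
  have old: "vdegree E4 x = vdegree E x + 2" if "x < n" for x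
    using that by (auto simp: vd X_def)
  have vab: "vdegree E4 ?a = card X + 3" "vdegree E4 ?b = card X + 3"
    using fin new by (simp_all add: vd)
  have vcd: "vdegree E4 ?c = card Y + 2" "vdegree E4 ?d = card Y + 2"
    using fin new lt by (fastforce simp add: vd)+
  have cX': "card X + 1 = (n + 1) div 2" using cX cY by presburger
  have nonadj: "vdegree E4 x + vdegree E4 y \<ge> n + 5"
    if xy: "x < y" "y < n + 4" "y \<notin> nbrs E4 x" for x y
  proof -
    have nby: "x \<notin> nbrs E4 y" using xy(3) by (simp add: nbrs_sym)
    consider "y < n" | "y = ?a" | "y = ?b" | "y = ?c" | "y = ?d" using xy(2) by linarith
    then show ?thesis
    proof cases
      case 1
      then have "y \<notin> nbrs E x" using nby xy by (auto simp: nb nbrs_sym split: if_splits)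
      then have "vdegree E x + vdegree E y \<ge> n + 1"
        using G 1 xy(1) by (auto simp: degree_sum_graph_iff_nbrs)
      then show ?thesis using 1 xy(1) old by simp
    next
      case 2
      then have "x \<in> Y" using xy nby by (auto simp: nb X_def)
      then show ?thesis using 2 vab old degY lt cX cY by fastforce
    next
      case 3
      then have "x \<in> Y" using xy nby by (auto simp: nb X_def)
      then show ?thesis using 3 vab old degY lt cX cY by fastforce
    next
      case 4
      then have "x < n" using xy nby by (auto simp: nb)
      then show ?thesis using 4 vcd old deg[of x] cX cX' by simp
    next
      case 5
      then have "x < n \<or> x = ?c" using xy nby by (auto simp: nb)
      then show ?thesis
      proof
        assume "x < n"
        then show ?thesis using 5 vcd old deg[of x] cX cX' by simp
      next
        assume "x = ?c"
        then show ?thesis using 5 vcd cY by simp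
      qed
    qed
  qed
  have D: "degree_sum_graph (n + 4) {..<n + 4} E4"
    unfolding degree_sum_graph_iff_nbrs
  proof (intro conjI ballI impI)
    fix x y assume "x \<in> {..<n + 4}" "y \<in> {..<n + 4}" "x \<noteq> y \<and> y \<notin> nbrs E4 x"
    then show "vdegree E4 x + vdegree E4 y \<ge> n + 4 + 1"
      using nonadj[of x y] nonadj[of y x] nbrs_sym[of y E4 x]
      by (cases "x < y") (auto simp: add.commute)
  qed (use S4 in auto)
  have "sharp_graph (n + 4) (insert ?c (insert ?d Y)) E4"
    unfolding sharp_graph_def
  proof (intro conjI allI impI ballI)
    show "4 * card E4 = (n + 4)\<^sup>2 + (n + 4) + excess (n + 4)"
      using e card4 by (simp add: excess_def power2_eq_square algebra_simps)
    show "insert ?c (insert ?d Y) \<subseteq> {..<n + 4}" using lt by fastforce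
    have "?c \<notin> Y" "?d \<notin> Y" using lt by fastforce+
    then show "card (insert ?c (insert ?d Y)) = (n + 4) div 2 + 1" using fin cY by simp
    show "(n + 4 + 1) div 2 \<le> vdegree E4 x" if "x < n + 4" for x
    proof -
      have "x < n \<or> x = ?a \<or> x = ?b \<or> x = ?c \<or> x = ?d" using that by linarith
      then show ?thesis using old deg[of x] vab vcd cX' cY by auto
    qed
    show "(n + 4) div 2 + 1 \<le> vdegree E4 y" if "y \<in> insert ?c (insert ?d Y)" for y
      using that old degY[of y] vcd cY lt(1)[of y] by auto
  qed (fact D)
  then show ?thesis by blast
qed

text \<open>Triangle and complete graph of order 4; the complete graph of order 5 without two disjoint
  edges; the complete graph of order 6 without two disjoint paths of length 2 centred at adjacent
  vertices.\<close>

lemma sharp_graph_base: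
  assumes "n \<in> {3, 4, 5, 6}"
  shows "\<exists>Y E. sharp_graph n Y E"
proof -
  have ext: "simple_graph {..<m'} (attach m S E)"
      "card (attach m S E) = card E + card S"
      "\<And>x. vdegree (attach m S E) x =
        (if x = m then card S else vdegree E x + (if x \<in> S then 1 else 0))"
      "\<And>x. nbrs (attach m S E) x =
        (if x = m then S else nbrs E x \<union> (if x \<in> S then {m} else {}))"
    if "simple_graph {..<m} E" "S \<subseteq> {..<m}" "m' = Suc m" for m m' :: nat and S E
    using simple_graph_attach[OF that(1) _ that(2), of m] card_attach[OF that(1) _ that(2), of m]
      vdegree_attach[OF that(1) _ that(2), of m] nbrs_attach[OF that(1) _ that(2), of m] that(3)
    by (simp_all add: lessThan_Suc)
  define K1 where "K1 = ({} :: nat set set)"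
  define K2 where "K2 = attach 1 {0} K1"
  define K3 where "K3 = attach 2 {0, 1} K2"
  define K4 where "K4 = attach 3 {0, 1, 2} K3"
  define H5 where "H5 = attach 4 {2, 3} K4"
  define G6 where "G6 = attach 5 {0, 1, 4} H5"
  define D2 where "D2 = attach 1 {} K1"
  define D3 where "D3 = attach 2 {0, 1} D2"
  define C4 where "C4 = attach 3 {0, 1} D3"
  define G5 where "G5 = attach 4 {0, 1, 2, 3} C4"
  have K1: "simple_graph {..<1} K1" "card K1 = 0" "\<And>x. vdegree K1 x = 0" "\<And>x. nbrs K1 x = {}"
    by (simp_all add: K1_def simple_graph_def vdegree_def nbrs_def)
  note K2 = ext[OF K1(1), of "{0}" 2, folded K2_def, simplified]
  note K3 = ext[OF K2(1), of "{0, 1}" 3, folded K3_def, simplified]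
  note K4 = ext[OF K3(1), of "{0, 1, 2}" 4, folded K4_def, simplified]
  note H5 = ext[OF K4(1), of "{2, 3}" 5, folded H5_def, simplified]
  note G6 = ext[OF H5(1), of "{0, 1, 4}" 6, folded G6_def, simplified]
  note D2 = ext[OF K1(1), of "{}" 2, folded D2_def, simplified]
  note D3 = ext[OF D2(1), of "{0, 1}" 3, folded D3_def, simplified]
  note C4 = ext[OF D3(1), of "{0, 1}" 4, folded C4_def, simplified]
  note G5 = ext[OF C4(1), of "{0, 1, 2, 3}" 5, folded G5_def, simplified]
  have all: "(\<forall>x\<in>{..<m}. Q x) \<longleftrightarrow> list_all Q [0..<m]"
      "(\<forall>x<m. Q x) \<longleftrightarrow> list_all Q [0..<m]" for m Q
    by (auto simp: list_all_iff)
  have upt: "[0..<3] = [0, 1, 2]" "[0..<4] = [0, 1, 2, 3]" "[0..<5] = [0, 1, 2, 3, 4]"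
      "[0..<6] = [0, 1, 2, 3, 4, 5]"
    by (simp_all add: upt_rec)
  note sharp = sharp_graph_def degree_sum_graph_iff_nbrs excess_def all upt
  have "sharp_graph 3 {0, 1} K3"
    by (simp add: sharp K1 K2 K3)
  moreover have "sharp_graph 4 {0, 1, 2} K4"
    by (simp add: sharp K1 K2 K3 K4)
  moreover have "sharp_graph 5 {0, 1, 2} G5"
    by (simp add: sharp K1 D2 D3 C4 G5)
  moreover have "sharp_graph 6 {0, 1, 2, 3} G6"
    by (simp add: sharp K1 K2 K3 K4 H5 G6)
  ultimately show ?thesis using assms by blast
qed

lemma sharp_graph_exists:
  assumes "n \<ge> 3"
  shows "\<exists>Y E. sharp_graph n Y E"
  using assms
proof (induction n rule: less_induct)
  case (less n)
  show ?case
  proof (cases "n \<le> 6")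
    case True
    then have "n \<in> {3, 4, 5, 6}" using less.prems by auto
    then show ?thesis by (rule sharp_graph_base)
  next
    case False
    then have "\<exists>Y E. sharp_graph (n - 4) Y E" by (intro less.IH) auto
    then obtain Y E where "sharp_graph (n - 4) Y E" by blast
    from sharp_graph_step[OF this] False show ?thesis by simp
  qed
qed

section \<open>The minimum size\<close>

text \<open>The case distinction on \<open>n = 4 * k + r\<close> is the evaluation of
  \<open>(n\<^sup>2 + n + excess n) / 4\<close>.\<close>

lemma bound_values:
  fixes n k :: nat
  assumes "k \<ge> 1"
  shows "n = 4 * k - 1 \<Longrightarrow> n\<^sup>2 + n + excess n = 4 * (4 * k\<^sup>2 - k)"
    and "n = 4 * k \<Longrightarrow> n\<^sup>2 + n + excess n = 4 * (4 * k\<^sup>2 + k + 1)"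
    and "n = 4 * k + 1 \<Longrightarrow> n\<^sup>2 + n + excess n = 4 * (4 * k\<^sup>2 + 3 * k + 1)"
    and "n = 4 * k + 2 \<Longrightarrow> n\<^sup>2 + n + excess n = 4 * (4 * k\<^sup>2 + 5 * k + 2)"
proof -
  show "n\<^sup>2 + n + excess n = 4 * (4 * k\<^sup>2 - k)" if "n = 4 * k - 1"
  proof -
    obtain j where j: "k = Suc j" using assms by (cases k) auto
    have n: "n = 4 * j + 3" using that j by simp
    then have "n mod 4 = 3" by presburger
    moreover have "4 * k\<^sup>2 - k = 4 * j * j + 7 * j + 3"
      by (simp add: j power2_eq_square algebra_simps)
    ultimately show ?thesis by (simp add: n excess_def power2_eq_square algebra_simps)
  qed
  show "n\<^sup>2 + n + excess n = 4 * (4 * k\<^sup>2 + k + 1)" if "n = 4 * k"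
    using that by (simp add: excess_def power2_eq_square algebra_simps)
  show "n\<^sup>2 + n + excess n = 4 * (4 * k\<^sup>2 + 3 * k + 1)" if "n = 4 * k + 1"
  proof -
    have "n mod 4 = 1" using that by presburger
    then show ?thesis using that by (simp add: excess_def power2_eq_square algebra_simps)
  qed
  show "n\<^sup>2 + n + excess n = 4 * (4 * k\<^sup>2 + 5 * k + 2)" if "n = 4 * k + 2"
  proof -
    have "n mod 4 = 2" using that by presburger
    then show ?thesis using that by (simp add: excess_def power2_eq_square algebra_simps)
  qed
qed

theorem theorem8:
  fixes n :: nat
  assumes "n \<ge> 3"
  shows
    "(\<forall>(V :: 'a set) E. degree_sum_graph n V E \<longrightarrow>
        (\<forall>k\<ge>1. (n = 4 * k - 1 \<longrightarrow> card E \<ge> 4 * k\<^sup>2 - k) \<and>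
               (n = 4 * k \<longrightarrow> card E \<ge> 4 * k\<^sup>2 + k + 1) \<and>
               (n = 4 * k + 1 \<longrightarrow> card E \<ge> 4 * k\<^sup>2 + 3 * k + 1) \<and>
               (n = 4 * k + 2 \<longrightarrow> card E \<ge> 4 * k\<^sup>2 + 5 * k + 2))) \<and>
     (\<exists>(V :: nat set) E. degree_sum_graph n V E \<and>
        (\<forall>k\<ge>1. (n = 4 * k - 1 \<longrightarrow> card E = 4 * k\<^sup>2 - k) \<and>
               (n = 4 * k \<longrightarrow> card E = 4 * k\<^sup>2 + k + 1) \<and>
               (n = 4 * k + 1 \<longrightarrow> card E = 4 * k\<^sup>2 + 3 * k + 1) \<and>
               (n = 4 * k + 2 \<longrightarrow> card E = 4 * k\<^sup>2 + 5 * k + 2))) \<and>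
     real (min_size n) = (real n)\<^sup>2 / 4 + real n / 4 +
       (if n mod 4 = 3 then 0 else if n mod 4 = 1 \<or> n mod 4 = 2 then 1 / 2 else 1)"
proof -
  obtain Y E where "sharp_graph n Y E" using sharp_graph_exists[OF assms] by blast
  then have G: "degree_sum_graph n {..<n} E" and E: "4 * card E = n\<^sup>2 + n + excess n"
    by (auto simp: sharp_graph_def)
  have "min_size n = card E"
    unfolding min_size_def
  proof (rule Least_equality)
    show "\<exists>(V :: nat set) E'. degree_sum_graph n V E' \<and> card E' = card E" using G by blast
    show "card E \<le> m" if "\<exists>(V :: nat set) E'. degree_sum_graph n V E' \<and> card E' = m" for m
      using that size_lower_bound[OF _ assms] E by fastforce
  qed
  then have "4 * min_size n = n\<^sup>2 + n + excess n" using E by simp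
  then have "4 * real (min_size n) = (real n)\<^sup>2 + real n + real (excess n)"
    by (metis of_nat_add of_nat_mult of_nat_numeral of_nat_power)
  moreover have "real (excess n) / 4 =
      (if n mod 4 = 3 then 0 else if n mod 4 = 1 \<or> n mod 4 = 2 then 1 / 2 else 1)"
  proof -
    have "n mod 4 = 0 \<or> n mod 4 = 1 \<or> n mod 4 = 2 \<or> n mod 4 = 3" by linarith
    then show ?thesis by (auto simp: excess_def)
  qed
  ultimately have size: "real (min_size n) = (real n)\<^sup>2 / 4 + real n / 4 +
      (if n mod 4 = 3 then 0 else if n mod 4 = 1 \<or> n mod 4 = 2 then 1 / 2 else 1)"
    by linarith
  show ?thesis
  proof (intro conjI allI impI exI)
    fix V :: "'a set" and E' k
    assume "degree_sum_graph n V E'" and k: "(1::nat) \<le> k"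
    then have le: "4 * card E' \<ge> n\<^sup>2 + n + excess n" using size_lower_bound assms by blast
    show "n = 4 * k - 1 \<Longrightarrow> card E' \<ge> 4 * k\<^sup>2 - k"
      using le bound_values(1)[OF k] by simp
    show "n = 4 * k \<Longrightarrow> card E' \<ge> 4 * k\<^sup>2 + k + 1"
      using le bound_values(2)[OF k] by simp
    show "n = 4 * k + 1 \<Longrightarrow> card E' \<ge> 4 * k\<^sup>2 + 3 * k + 1"
      using le bound_values(3)[OF k] by simp
    show "n = 4 * k + 2 \<Longrightarrow> card E' \<ge> 4 * k\<^sup>2 + 5 * k + 2"
      using le bound_values(4)[OF k] by simp
  next
    fix k assume k: "(1::nat) \<le> k"
    show "n = 4 * k - 1 \<Longrightarrow> card E = 4 * k\<^sup>2 - k"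
      using E bound_values(1)[OF k] by simp
    show "n = 4 * k \<Longrightarrow> card E = 4 * k\<^sup>2 + k + 1"
      using E bound_values(2)[OF k] by simp
    show "n = 4 * k + 1 \<Longrightarrow> card E = 4 * k\<^sup>2 + 3 * k + 1"
      using E bound_values(3)[OF k] by simp
    show "n = 4 * k + 2 \<Longrightarrow> card E = 4 * k\<^sup>2 + 5 * k + 2"
      using E bound_values(4)[OF k] by simp
  qed (fact G size)+
qed

end
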